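(* For every fixed positive integer $k$, $$\mathrm{bp}_k(K_n) = (1+o(1))\,n \quad \text{as } n \to \infty .$$
   Context: A biclique of a graph $G$ is a (not necessarily induced) subgraph of $G$ isomorphic to a complete bipartite graph $K_{s,t}$ with $s,t \geq 1$. For a positive integer $k$, $\mathrm{bp}_k(G)$ denotes the size $\ell$ of the smallest collection $\{H_1,\dots,H_\ell\}$ of bicliques $H_i \subset G$ (a biclique may be repeated) such that each edge of $G$ belongs to $H_i$ for exactly $k$ different values of $i \in \{1,\dots,\ell\}$. $K_n$ is the complete graph on $n$ vertices. *)

theory Defs
  imports
    Complex_Main
    "HOL-Library.Landau_Symbols"
    "Graph_Theory.Kuratowski"
begin

text \<open>
  As in the library, an undirected simple graph is a finite, symmetric, loop-free digraph without
  parallel arcs (locale \<^locale>\<open>graph\<close>); an edge is a pair of opposite arcs.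
\<close>

definition complete_graph :: "nat \<Rightarrow> (nat, nat \<times> nat) pre_digraph" where
  "complete_graph n =
    \<lparr> verts = {..<n}, arcs = {(u, v). u < n \<and> v < n \<and> u \<noteq> v}, tail = fst, head = snd \<rparr>"

lemma complete_digraph_complete_graph: "complete_digraph n (complete_graph n)"
proof -
  have fin: "finite {(u, v). u < n \<and> v < n \<and> u \<noteq> (v::nat)}"
    by (rule finite_subset[of _ "{..<n} \<times> {..<n}"]) auto
  have "wf_digraph (complete_graph n)"
    by unfold_locales (auto simp: complete_graph_def)
  moreover have "symmetric (complete_graph n)"
    by (auto simp: symmetric_def arcs_ends_def arc_to_ends_def complete_graph_def intro!: symI)
  ultimately have "graph (complete_graph n)"
    using fin by unfold_locales (auto simp: complete_graph_def arc_to_ends_def)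
  then show ?thesis
    by (auto simp: complete_digraph_def arcs_ends_def arc_to_ends_def complete_graph_def)
qed

definition biclique :: "('a, 'b) pre_digraph \<Rightarrow> ('a, 'b) pre_digraph \<Rightarrow> bool" where
  "biclique H G \<longleftrightarrow>
    subgraph H G \<and> (\<exists>s t. 1 \<le> s \<and> 1 \<le> t \<and> complete_bipartite_digraph s t H)"

text \<open>
  Bicliques are symmetric, so if \<open>G\<close> is a graph the two arcs of an edge of \<open>G\<close> lie in the same
  members of the collection; the condition on all arcs is the condition on all edges.
\<close>

definition biclique_covering ::
  "nat \<Rightarrow> ('a, 'b) pre_digraph \<Rightarrow> nat \<Rightarrow> (nat \<Rightarrow> ('a, 'b) pre_digraph) \<Rightarrow> bool" where
  "biclique_covering k G l H \<longleftrightarrow>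
    (\<forall>i\<in>{1..l}. biclique (H i) G) \<and>
    (\<forall>e\<in>arcs G. card {i\<in>{1..l}. e \<in> arcs (H i)} = k)"

definition bp :: "nat \<Rightarrow> ('a, 'b) pre_digraph \<Rightarrow> nat" where
  "bp k G = (LEAST l. \<exists>H. biclique_covering k G l H)"

end

theory Submission
  imports Defs "Jordan_Normal_Form.Determinant" "HOL-Real_Asymp.Real_Asymp"
begin

text \<open>
  The number of bicliques is at least \<open>n - 1\<close> by the argument of Graham and Pollak
  (\<open>biclique_covering_complete_graph_ge\<close>): with fewer, some nonzero vector \<open>x\<close> has entry sum zero and
  sums to zero over one side of every biclique. The quadratic form \<open>\<Sum>u\<noteq>v. x u * x v\<close> then vanishes,
  since \<open>k\<close> times it splits over the bicliques into products with a zero factor; but it is also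
  \<open>(\<Sum>v. x v)\<^sup>2 - (\<Sum>v. (x v)\<^sup>2) < 0\<close>.

  For the upper bound, a partition of the vertices into \<open>M\<close> numbered classes gives at most \<open>M\<close>
  bicliques, each joining a class to the union of all later ones, and together they contain every
  edge between different classes exactly once. Take \<open>k\<close> partitions such that two distinct vertices
  share a class in at most one of them. Every edge is then contained in \<open>k\<close> or \<open>k - 1\<close> of the
  \<open>k * M\<close> bicliques, and the edges that still have to be contained once more form a simple graph. Any
  graph on \<open>n\<close> vertices decomposes into at most \<open>n\<close> stars, so that \<open>n + k * M\<close> bicliques suffice
  (\<open>biclique_covering_from_partitions\<close>). The correction thus costs \<open>n\<close> once and not \<open>k\<close> times,
  and \<open>M\<close> can be made small: lay the vertices out in a square grid of side \<open>m\<close> with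
  \<open>m\<^sup>2 \<ge> n\<close> and let the partitions be the parallel classes of lines of \<open>k\<close> different slopes. Two
  points lie on at most one common line, and each slope needs only \<open>O(m) = O(sqrt n)\<close> lines for
  fixed \<open>k\<close> (\<open>biclique_covering_complete_graph_grid\<close>).
\<close>

section \<open>Bicliques of a complete graph\<close>

lemma biclique_complete_graphE:
  assumes "biclique H (complete_graph n)"
  obtains U V where "U \<subseteq> {..<n}" "V \<subseteq> {..<n}" "U \<inter> V = {}" "arcs H = U \<times> V \<union> V \<times> U"
proof -
  from assms have sub: "subgraph H (complete_graph n)"
    and "\<exists>s t. complete_bipartite_digraph s t H"
    by (auto simp: biclique_def)
  then obtain U V where UV: "verts H = U \<union> V" "U \<inter> V = {}" "arcs_ends H = U \<times> V \<union> V \<times> U"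
    by (auto simp: complete_bipartite_digraph_def)
  from sub have "tail H = fst" "head H = snd" "verts H \<subseteq> {..<n}"
    by (auto simp: subgraph_def compatible_def complete_graph_def)
  then have "arcs_ends H = arcs H"
    by (simp add: arcs_ends_conv)
  with UV \<open>verts H \<subseteq> {..<n}\<close> show thesis
    by (intro that[of U V]) auto
qed

lemma biclique_complete_graphI:
  assumes "U \<subseteq> {..<n}" "V \<subseteq> {..<n}" "U \<inter> V = {}" "U \<noteq> {}" "V \<noteq> {}"
  shows "biclique \<lparr>verts = U \<union> V, arcs = U \<times> V \<union> V \<times> U, tail = fst, head = snd\<rparr> (complete_graph n)"
    (is "biclique ?H _")
proof -
  have fin: "finite U" "finite V"
    using assms finite_subset by blast+
  have ends: "arcs_ends ?H = U \<times> V \<union> V \<times> U"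
    by (simp add: arcs_ends_conv)
  have "graph ?H"
    using assms(3) fin
    by unfold_locales (auto simp: symmetric_def ends arc_to_ends_def intro!: symI)
  then have "complete_bipartite_digraph (card U) (card V) ?H"
    unfolding complete_bipartite_digraph_def ends using assms(3)
    by (intro conjI exI[of _ U] exI[of _ V]) auto
  moreover have "wf_digraph (complete_graph n)"
    using complete_digraph_complete_graph[of n]
    by (simp add: complete_digraph_def graph_def digraph_def fin_digraph_def)
  then have "subgraph ?H (complete_graph n)"
    using assms \<open>graph ?H\<close>
    by (auto simp: subgraph_def compatible_def complete_graph_def graph_def digraph_def
        fin_digraph_def)
  moreover have "1 \<le> card U" "1 \<le> card V"
    using assms fin by (simp_all add: Suc_le_eq card_gt_0_iff)
  ultimately show ?thesis
    by (auto simp: biclique_def)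
qed

lemma image_restrict_eq:
  assumes "f ` S = T"
  shows "f ` {x\<in>S. P (f x)} = {y\<in>T. P y}"
  using assms by blast

text \<open>
  Coverings can be described by pairs of disjoint vertex sets over an arbitrary finite index set,
  and one of the two sets may be empty. Such degenerate pairs contain no edge, so dropping them
  preserves the multiplicities; this is why only an upper bound on the number of bicliques remains.
\<close>

lemma biclique_covering_complete_graph_exists:
  fixes I :: "'i set" and A B :: "'i \<Rightarrow> nat set"
  assumes "finite I"
    and sub: "\<And>i. i \<in> I \<Longrightarrow> A i \<subseteq> {..<n}" "\<And>i. i \<in> I \<Longrightarrow> B i \<subseteq> {..<n}"
    and disj: "\<And>i. i \<in> I \<Longrightarrow> A i \<inter> B i = {}"
    and count: "\<And>u v. u < v \<Longrightarrow> v < n \<Longrightarrow>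
      card {i\<in>I. u \<in> A i \<and> v \<in> B i \<or> v \<in> A i \<and> u \<in> B i} = k"
  obtains l H where "l \<le> card I" "biclique_covering k (complete_graph n) l H"
proof -
  define J where "J = {i\<in>I. A i \<noteq> {} \<and> B i \<noteq> {}}"
  define K where "K i = \<lparr>verts = A i \<union> B i, arcs = A i \<times> B i \<union> B i \<times> A i,
    tail = fst, head = snd\<rparr>" for i
  have "finite J"
    using \<open>finite I\<close> by (simp add: J_def)
  then obtain h where h: "bij_betw h {1..card J} J"
    using ex_bij_betw_nat_finite_1 by blast
  have "biclique (K i) (complete_graph n)" if "i \<in> J" for i
    unfolding K_def using that sub disj by (intro biclique_complete_graphI) (auto simp: J_def)
  moreover have "card {i\<in>{1..card J}. e \<in> arcs (K (h i))} = k"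
    if e: "e \<in> arcs (complete_graph n)" for e
  proof -
    obtain u v where uv: "e = (u, v)" "u < n" "v < n" "u \<noteq> v"
      using e by (auto simp: complete_graph_def)
    have "bij_betw h {i\<in>{1..card J}. e \<in> arcs (K (h i))} {i\<in>J. e \<in> arcs (K i)}"
    proof (rule bij_betw_subset[OF h])
      have "h ` {1..card J} = J"
        using h by (rule bij_betw_imp_surj_on)
      then show "h ` {i\<in>{1..card J}. e \<in> arcs (K (h i))} = {i\<in>J. e \<in> arcs (K i)}"
        by (rule image_restrict_eq)
    qed auto
    then have "card {i\<in>{1..card J}. e \<in> arcs (K (h i))} = card {i\<in>J. e \<in> arcs (K i)}"
      by (rule bij_betw_same_card)
    also have "{i\<in>J. e \<in> arcs (K i)} =
      {i\<in>I. min u v \<in> A i \<and> max u v \<in> B i \<or> max u v \<in> A i \<and> min u v \<in> B i}"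
      by (auto simp: J_def K_def uv min_def max_def)
    also have "card \<dots> = k"
      using uv by (intro count) auto
    finally show ?thesis .
  qed
  ultimately have "biclique_covering k (complete_graph n) (card J) (K \<circ> h)"
    using bij_betwE[OF h] by (simp add: biclique_covering_def)
  moreover have "card J \<le> card I"
    using \<open>finite I\<close> by (auto simp: J_def intro: card_mono)
  ultimately show thesis
    using that by blast
qed

section \<open>Coverings from families of partitions\<close>

text \<open>
  The values of \<open>f a\<close> number the classes of the \<open>a\<close>-th partition. For each \<open>a\<close>, an edge between
  different classes lies in exactly one class-to-later-classes biclique, namely that of the smaller
  class number. By the separation hypothesis an edge fails to be contained in this way for at most
  one \<open>a\<close>, and if there is one, the star centred at the smaller end of the edge makes up for it.
\<close>

lemma biclique_covering_from_partitions:
  fixes f :: "nat \<Rightarrow> nat \<Rightarrow> nat"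
  assumes bound: "\<And>a v. a < k \<Longrightarrow> v < n \<Longrightarrow> f a v < M"
    and sep: "\<And>a b u v. a < k \<Longrightarrow> b < k \<Longrightarrow> a \<noteq> b \<Longrightarrow> u < n \<Longrightarrow> v < n \<Longrightarrow>
      f a u = f a v \<Longrightarrow> f b u = f b v \<Longrightarrow> u = v"
  obtains l H where "l \<le> n + k * M" "biclique_covering k (complete_graph n) l H"
proof -
  \<comment> \<open>The left summand indexes the stars by their centres, the right one indexes the classes.\<close>
  define I where "I = {..<n} <+> ({..<k} \<times> {..<M})"
  define A where "A = case_sum (\<lambda>w. {w}) (\<lambda>(a, c). {v. v < n \<and> f a v = c})"
  define B where "B = case_sum (\<lambda>w. {v. w < v \<and> v < n \<and> (\<exists>a<k. f a w = f a v)})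
    (\<lambda>(a, c). {v. v < n \<and> c < f a v})"
  have fin: "finite I"
    by (simp add: I_def)
  have sub: "A i \<subseteq> {..<n}" "B i \<subseteq> {..<n}" "A i \<inter> B i = {}" if "i \<in> I" for i
    using that by (auto simp: I_def A_def B_def)
  have count: "card {i\<in>I. u \<in> A i \<and> v \<in> B i \<or> v \<in> A i \<and> u \<in> B i} = k"
    if uv: "u < v" "v < n" for u v
  proof -
    let ?S = "{w. w = u \<and> (\<exists>a<k. f a u = f a v)}"
    let ?D = "{a. a < k \<and> f a u \<noteq> f a v}"
    let ?g = "\<lambda>a. (a, min (f a u) (f a v))"
    have "{i\<in>I. u \<in> A i \<and> v \<in> B i \<or> v \<in> A i \<and> u \<in> B i} = ?S <+> ?g ` ?D"
      using uv bound by (auto simp: I_def A_def B_def min_def image_iff not_le split: if_splits)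
    then have "card {i\<in>I. u \<in> A i \<and> v \<in> B i \<or> v \<in> A i \<and> u \<in> B i} = card ?S + card (?g ` ?D)"
      by (simp add: card_Plus)
    also have "card (?g ` ?D) = card ?D"
      by (intro card_image) (auto simp: inj_on_def)
    also have "card ?S + card ?D = k"
    proof (cases "\<exists>a<k. f a u = f a v")
      case True
      then obtain a where a: "a < k" "f a u = f a v"
        by blast
      have "?D = {..<k} - {a}"
      proof (intro equalityI subsetI)
        fix b assume b: "b \<in> {..<k} - {a}"
        then show "b \<in> ?D"
          using sep[of a b u v] a uv by auto
      qed (use a in auto)
      then show ?thesis
        using a True by simp
    next
      case False
      then have "?D = {..<k}"
        by auto
      with False show ?thesis
        by simp
    qed
    finally show ?thesis .
  qed
  obtain l H where "l \<le> card I" "biclique_covering k (complete_graph n) l H"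
    using fin sub count by (rule biclique_covering_complete_graph_exists)
  moreover have "card I = n + k * M"
    by (simp add: I_def card_Plus)
  ultimately show thesis
    by (intro that) simp_all
qed

text \<open>
  With \<open>v\<close> placed at the grid point \<open>(v div m, v mod m)\<close>, the value \<open>v mod m + a * (v div m)\<close>
  identifies the line of slope \<open>- a\<close> through it.
\<close>

lemma slope_partitions_separate:
  fixes a b m u v :: nat
  assumes "a \<noteq> b"
    and "u mod m + a * (u div m) = v mod m + a * (v div m)"
    and "u mod m + b * (u div m) = v mod m + b * (v div m)"
  shows "u = v"
proof -
  have "(int a - int b) * (int (u div m) - int (v div m)) = 0"
    using assms(2,3)[THEN arg_cong[of _ _ int]] by (simp add: algebra_simps)
  then have "u div m = v div m"
    using \<open>a \<noteq> b\<close> by simp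
  moreover from this have "u mod m = v mod m"
    using assms(2) by simp
  ultimately show ?thesis
    by (metis div_mult_mod_eq)
qed

lemma biclique_covering_complete_graph_grid:
  assumes "n \<le> m * m"
  obtains l H where "l \<le> n + k * (k * m)" "biclique_covering k (complete_graph n) l H"
proof -
  have bound: "v mod m + a * (v div m) < k * m" if "a < k" "v < n" for a v
  proof -
    have "v < m * m" "0 < m"
      using assms that by (auto intro: Nat.gr0I)
    then have "v div m < m" "v mod m < m"
      by (simp_all add: less_mult_imp_div_less)
    then have "v mod m + a * (v div m) < m + a * m"
      by (intro add_less_le_mono mult_le_mono2) auto
    also have "\<dots> = Suc a * m"
      by simp
    also have "\<dots> \<le> k * m"
      using that by (intro mult_le_mono1) auto
    finally show ?thesis .
  qed
  obtain l H where "l \<le> n + k * (k * m)" "biclique_covering k (complete_graph n) l H"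
    by (rule biclique_covering_from_partitions[of k n "\<lambda>a v. v mod m + a * (v div m)" "k * m"])
      (use bound slope_partitions_separate in blast)+
  then show thesis
    by (rule that)
qed

section \<open>The lower bound of Graham and Pollak\<close>

text \<open>
  The \<open>m\<close> equations are the first rows of a square matrix with a zero row, which is singular.
\<close>

lemma homogeneous_system_nontrivial_solution:
  fixes c :: "nat \<Rightarrow> nat \<Rightarrow> 'a::field"
  assumes "m < n"
  obtains x where "\<exists>j<n. x j \<noteq> 0" "\<And>i. i < m \<Longrightarrow> (\<Sum>j<n. c i j * x j) = 0"
proof -
  define r where "r i = (if i = m then 0\<^sub>v n else vec n (c i))" for i
  define M where "M = mat\<^sub>r n n r"
  have "det M = 0"
    unfolding M_def r_def using assms by (intro det_row_0) auto
  moreover have M: "M \<in> carrier_mat n n"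
    by (simp add: M_def)
  ultimately obtain x where x: "x \<in> carrier_vec n" "x \<noteq> 0\<^sub>v n" "M *\<^sub>v x = 0\<^sub>v n"
    using det_0_iff_vec_prod_zero_field[OF M] by blast
  have "(\<Sum>j<n. c i j * x $ j) = 0" if "i < m" for i
  proof -
    have "(M *\<^sub>v x) $ i = 0"
      using x(3) that assms by simp
    moreover have "(M *\<^sub>v x) $ i = (\<Sum>j<n. c i j * x $ j)"
      using that assms x(1) by (simp add: M_def r_def scalar_prod_def lessThan_atLeast0)
    ultimately show ?thesis by simp
  qed
  moreover have "\<exists>j<n. x $ j \<noteq> 0"
    using x(1,2) by (metis carrier_vecD eq_vecI index_zero_vec)
  ultimately show thesis
    using that by blast
qed

text \<open>
  A covering by fewer than \<open>n - 1\<close> bicliques imposes fewer than \<open>n\<close> linear conditions on \<open>x\<close>: one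
  for each biclique and one for the sum of all entries.
\<close>

lemma biclique_covering_complete_graph_ge:
  assumes "biclique_covering k (complete_graph n) l H" "k \<ge> 1"
  shows "n \<le> l + 1"
proof (rule ccontr)
  assume "\<not> n \<le> l + 1"
  then have less: "l + 1 < n" by simp
  let ?E = "arcs (complete_graph n)"
  have "\<exists>U V. U \<subseteq> {..<n} \<and> V \<subseteq> {..<n} \<and> U \<inter> V = {} \<and> arcs (H i) = U \<times> V \<union> V \<times> U"
    if "i \<in> {1..l}" for i
  proof -
    have "biclique (H i) (complete_graph n)"
      using assms(1) that by (simp add: biclique_covering_def)
    then obtain U V where "U \<subseteq> {..<n}" "V \<subseteq> {..<n}" "U \<inter> V = {}"
        "arcs (H i) = U \<times> V \<union> V \<times> U"
      by (rule biclique_complete_graphE)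
    then show ?thesis
      by (intro exI[of _ U] exI[of _ V] conjI)
  qed
  then obtain U V where UV: "\<And>i. i \<in> {1..l} \<Longrightarrow> U i \<subseteq> {..<n} \<and> V i \<subseteq> {..<n} \<and>
      U i \<inter> V i = {} \<and> arcs (H i) = U i \<times> V i \<union> V i \<times> U i"
    by metis
  \<comment> \<open>Bicliques are numbered from 1, so row 0 is free for the sum of all entries.\<close>
  define c :: "nat \<Rightarrow> nat \<Rightarrow> real"
    where "c i j = (if i = 0 then 1 else of_bool (j \<in> U i))" for i j
  obtain x where nz: "\<exists>j<n. x j \<noteq> 0" and x: "\<And>i. i < l + 1 \<Longrightarrow> (\<Sum>j<n. c i j * x j) = 0"
    using homogeneous_system_nontrivial_solution[OF less] by blast
  have sum0: "(\<Sum>j<n. x j) = 0"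
    using x[of 0] by (simp add: c_def)
  have sumU: "(\<Sum>j\<in>U i. x j) = 0" if "i \<in> {1..l}" for i
  proof -
    have "(\<Sum>j\<in>U i. x j) = (\<Sum>j<n. c i j * x j)"
      using UV[OF that] that by (intro sum.mono_neutral_cong_left) (auto simp: c_def)
    then show ?thesis using x[of i] that by simp
  qed
  define w where "w e = x (fst e) * x (snd e)" for e
  have finE: "finite ?E"
    by (rule finite_subset[of _ "{..<n} \<times> {..<n}"]) (auto simp: complete_graph_def)
  have w_prod: "sum w (S \<times> T) = sum x S * sum x T" for S T
    by (simp add: w_def sum_product sum.cartesian_product case_prod_unfold)
  have wH: "sum w (arcs (H i)) = 0" if "i \<in> {1..l}" for i
  proof -
    have fin: "finite (U i)" "finite (V i)"
      using UV[OF that] finite_subset by blast+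
    have "sum w (arcs (H i)) = sum w (U i \<times> V i) + sum w (V i \<times> U i)"
      using UV[OF that] fin by (simp, subst sum.union_disjoint) auto
    then show ?thesis
      using sumU[OF that] by (simp add: w_prod)
  qed
  \<comment> \<open>Counting every edge with its multiplicity \<open>k\<close> regroups the quadratic form by bicliques.\<close>
  have "real k * sum w ?E = (\<Sum>e\<in>?E. \<Sum>i\<in>{i\<in>{1..l}. e \<in> arcs (H i)}. w e)"
    using assms(1) by (simp add: biclique_covering_def sum_distrib_left)
  also have "\<dots> = (\<Sum>i=1..l. \<Sum>e\<in>{e\<in>?E. e \<in> arcs (H i)}. w e)"
    using finE by (intro sum.swap_restrict) auto
  also have "\<dots> = (\<Sum>i=1..l. sum w (arcs (H i)))"
  proof (intro sum.cong refl)
    fix i assume i: "i \<in> {1..l}"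
    have "arcs (H i) \<subseteq> ?E"
      using UV[OF i] by (fastforce simp: complete_graph_def)
    then show "{e\<in>?E. e \<in> arcs (H i)} = arcs (H i)" by auto
  qed
  also have "\<dots> = 0"
    using wH by simp
  finally have "sum w ?E = 0"
    using \<open>k \<ge> 1\<close> by simp
  \<comment> \<open>The edges are all pairs off the diagonal, so the diagonal carries the remaining weight.\<close>
  have "0 = sum w ({..<n} \<times> {..<n})"
    using sum0 by (simp add: w_prod)
  also have "{..<n} \<times> {..<n} = ?E \<union> (\<lambda>j. (j, j)) ` {..<n}"
    by (auto simp: complete_graph_def)
  also have "sum w \<dots> = sum w ?E + sum w ((\<lambda>j. (j, j)) ` {..<n})"
    using finE by (intro sum.union_disjoint) (auto simp: complete_graph_def)
  also have "\<dots> = (\<Sum>j<n. (x j)\<^sup>2)"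
    using \<open>sum w ?E = 0\<close> by (simp add: sum.reindex inj_on_def w_def power2_eq_square)
  finally have "(\<Sum>j<n. (x j)\<^sup>2) = 0"
    by simp
  then have "\<forall>j\<in>{..<n}. (x j)\<^sup>2 = 0"
    by (subst (asm) sum_nonneg_eq_0_iff) auto
  then show False
    using nz by auto
qed

section \<open>The asymptotics\<close>

theorem theorem1p2:
  fixes k :: nat
  assumes "k \<ge> 1"
  shows "(\<lambda>n. real (bp k (complete_graph n))) \<sim>[at_top] (\<lambda>n. real n)"
proof (rule asymp_equivI')
  let ?b = "\<lambda>n. real (bp k (complete_graph n))"
  have bounds: "real n - 1 \<le> ?b n \<and> ?b n \<le> real n + real k * (real k * (sqrt (real n) + 1))" for n
  proof -
    define m where "m = nat \<lceil>sqrt (real n)\<rceil>"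
    have m: "sqrt (real n) \<le> real m" "real m \<le> sqrt (real n) + 1"
      by (auto simp: m_def of_nat_nat)
    have "real n = sqrt (real n) * sqrt (real n)"
      by simp
    also have "\<dots> \<le> real m * real m"
      using m(1) by (intro mult_mono) auto
    finally have "n \<le> m * m"
      by (metis of_nat_le_iff of_nat_mult)
    then obtain l H where lH: "l \<le> n + k * (k * m)" "biclique_covering k (complete_graph n) l H"
      using biclique_covering_complete_graph_grid[of n m k] by metis
    let ?P = "\<lambda>l. \<exists>H. biclique_covering k (complete_graph n) l H"
    have "?P l"
      by (rule exI[of _ H]) (rule lH(2))
    then have "?P (bp k (complete_graph n))" and le: "bp k (complete_graph n) \<le> l"
      unfolding bp_def by (rule LeastI[of ?P], rule Least_le[of ?P])
    then have "n \<le> bp k (complete_graph n) + 1"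
      using assms by (elim exE) (rule biclique_covering_complete_graph_ge)
    moreover from le
    have "?b n \<le> real (n + k * (k * m))"
      using lH(1) by (intro of_nat_mono) simp
    then have "?b n \<le> real n + real k * (real k * real m)"
      by simp
    moreover have "real k * (real k * real m) \<le> real k * (real k * (sqrt (real n) + 1))"
      using m(2) by (intro mult_left_mono) auto
    ultimately show ?thesis
      by linarith
  qed
  show "(\<lambda>n. ?b n / real n) \<longlonglongrightarrow> 1"
  proof (rule tendsto_sandwich)
    show "\<forall>\<^sub>F n in sequentially. (real n - 1) / real n \<le> ?b n / real n"
      using bounds by (intro always_eventually allI divide_right_mono) auto
    show "\<forall>\<^sub>F n in sequentially. ?b n / real n \<le>
        (real n + real k * (real k * (sqrt (real n) + 1))) / real n"
      using bounds by (intro always_eventually allI divide_right_mono) auto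
    show "(\<lambda>n. (real n - 1) / real n) \<longlonglongrightarrow> 1"
      by real_asymp
    show "(\<lambda>n. (real n + real k * (real k * (sqrt (real n) + 1))) / real n) \<longlonglongrightarrow> 1"
      by real_asymp
  qed
qed

end
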